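(* Let $q$ be a prime power and let $q-1=de$ with $d,e$ positive integers. (i) Let $\ell$ be an integer with $0\le \ell\le e$ and $f=x^{e-\ell}$. For any $a,b\in\mathbb{F}_q$ with $a\neq0$, $b\neq 0$, the number of $x\in\mathbb{F}_q$ with $f(x)=ax+b$ is at most $(\ell+1)(q-1)/e$. (ii) Let $m\ge 1$ be an integer and $f=x^{e+m}$. For any $a,b\in\mathbb{F}_q$ with $a\neq 0$, $b\neq 0$, the number of $x\in\mathbb{F}_q$ with $f(x)=ax+b$ is at most $m(q-1)/e$. *)

theory Defs
  imports Complex_Main "HOL-Library.Cardinality" "HOL-Number_Theory.Prime_Powers"
begin

end

theory Submission
  imports Defs "HOL-Computational_Algebra.Polynomial"
begin

text \<open>
  For \<open>x \<noteq> 0\<close> put \<open>z = x ^ e\<close>; then \<open>z ^ d = x ^ (q - 1) = 1\<close>, so \<open>z\<close> takes at most \<open>d\<close> values.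
  For fixed \<open>z\<close> the equation \<open>x ^ (e - l) = a * x + b\<close>, multiplied by \<open>x ^ l\<close>, becomes
  \<open>z = x ^ l * (a * x + b)\<close>, of degree \<open>l + 1\<close>, and \<open>x ^ (e + m) = a * x + b\<close> becomes
  \<open>z * x ^ m = a * x + b\<close>, of degree at most \<open>m\<close>. Summing over \<open>z\<close> gives the bounds.
  The value \<open>x = 0\<close> can be a solution only if \<open>l = e\<close>, where the equation is linear.
\<close>

text \<open>Multiplication by \<open>x\<close> permutes the nonzero elements, so it preserves their
  product while contributing a factor \<open>x\<close> for each of them; this product is nonzero and
  cancels.\<close>

lemma power_CARD_minus_1_eq_1:
  fixes x :: "'a :: {field, finite}"
  assumes "x \<noteq> 0"
  shows "x ^ (CARD('a) - 1) = 1"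
proof -
  let ?P = "\<Prod>y\<in>UNIV - {0::'a}. y"
  have "bij_betw ((*) x) (UNIV - {0}) (UNIV - {0})"
    by (rule bij_betw_byWitness[where f' = "\<lambda>y. y / x"]) (use assms in auto)
  then have "?P = (\<Prod>y\<in>UNIV - {0}. x * y)"
    by (rule prod.reindex_bij_betw[symmetric])
  also have "\<dots> = x ^ (CARD('a) - 1) * ?P"
    by (simp add: prod.distrib card_Diff_singleton)
  finally show ?thesis
    by simp
qed

lemma card_roots_of_unity_le:
  assumes "d > 0"
  shows "card {z :: 'a :: idom. z ^ d = 1} \<le> d"
proof -
  let ?p = "monom 1 d - 1 :: 'a poly"
  have "coeff ?p d = 1"
    using assms by simp
  then have "?p \<noteq> 0"
    by (metis coeff_0 zero_neq_one)
  then have "card {z. poly ?p z = 0} \<le> degree ?p"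
    by (rule card_poly_roots_bound)
  also have "degree ?p \<le> d"
    by (intro degree_diff_le degree_monom_le) simp
  finally show ?thesis
    by (simp add: poly_monom)
qed

lemma card_le_mult_fibres:
  assumes "finite T" and "f ` S \<subseteq> T"
    and "\<And>z. z \<in> T \<Longrightarrow> card {x \<in> S. f x = z} \<le> k"
  shows "card S \<le> card T * k"
proof -
  have "S = (\<Union>z\<in>T. {x \<in> S. f x = z})"
    using assms(2) by auto
  then have "card S = card (\<Union>z\<in>T. {x \<in> S. f x = z})"
    by (rule arg_cong)
  also have "\<dots> \<le> (\<Sum>z\<in>T. card {x \<in> S. f x = z})"
    by (rule card_UN_le[OF assms(1)])
  also have "\<dots> \<le> card T * k"
    using sum_bounded_above[of T "\<lambda>z. card {x \<in> S. f x = z}" k] assms(3) by simp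
  finally show ?thesis .
qed

text \<open>The core shared by both bounds: on a fibre of \<open>x ^ e\<close> the value
  \<open>z\<close> is a constant, so the polynomial may depend on it. Zero is excluded because its
  \<open>e\<close>-th power is not a \<open>d\<close>-th root of unity.\<close>

lemma card_le_mult_power_fibres:
  fixes S :: "'a :: {field, finite} set"
  assumes "CARD('a) - 1 = d * e" and "d > 0" and "0 \<notin> S"
    and p: "\<And>z. p z \<noteq> 0" "\<And>z. degree (p z) \<le> k"
    and roots: "\<And>x. x \<in> S \<Longrightarrow> poly (p (x ^ e)) x = 0"
  shows "card S \<le> d * k"
proof -
  let ?T = "{z :: 'a. z ^ d = 1}"
  have "card {x \<in> S. x ^ e = z} \<le> k" for z
  proof -
    have "card {x \<in> S. x ^ e = z} \<le> card {x. poly (p z) x = 0}"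
      by (intro card_mono) (use roots in auto)
    also have "\<dots> \<le> degree (p z)"
      by (rule card_poly_roots_bound[OF p(1)])
    also have "\<dots> \<le> k"
      by (rule p(2))
    finally show ?thesis .
  qed
  moreover have "(\<lambda>x. x ^ e) ` S \<subseteq> ?T"
  proof clarify
    fix x assume "x \<in> S"
    with assms(3) have "x ^ (d * e) = 1"
      using power_CARD_minus_1_eq_1[of x] assms(1) by auto
    then show "(x ^ e) ^ d = 1"
      by (simp add: mult.commute flip: power_mult)
  qed
  ultimately have "card S \<le> card ?T * k"
    by (intro card_le_mult_fibres) auto
  also have "\<dots> \<le> d * k"
    by (intro mult_right_mono card_roots_of_unity_le assms(2)) simp
  finally show ?thesis .
qed

lemma card_power_diff_eq_linear_le:
  fixes a b :: "'a :: {field, finite}"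
  assumes "CARD('a) - 1 = d * e" and "d > 0" and "l \<le> e" and "a \<noteq> 0" and "b \<noteq> 0"
  shows "card {x. x ^ (e - l) = a * x + b} \<le> d * (l + 1)"
proof (cases "l = e")
  case True
  \<comment> \<open>Here the exponent is 0 and \<open>0 ^ 0 = 1\<close>, so the equation reads
    \<open>1 = a * x + b\<close> for every \<open>x\<close>, including 0.\<close>
  have "{x. x ^ (e - l) = a * x + b} \<subseteq> {(1 - b) / a}"
    using True assms(4) by (auto simp: field_simps)
  then have "card {x. x ^ (e - l) = a * x + b} \<le> card {(1 - b) / a}"
    by (intro card_mono) auto
  also have "\<dots> \<le> d * (l + 1)"
    using assms(2) by simp
  finally show ?thesis .
next
  case False
  define p where "p z = monom a (l + 1) + monom b l - [:z:]" for z
  \<comment> \<open>The leading coefficient does not involve \<open>z\<close>, so no fibre yields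
    the zero polynomial.\<close>
  have "coeff (p z) (l + 1) = a" for z
    by (simp add: p_def)
  then have "p z \<noteq> 0" for z
    using assms(4) by (metis coeff_0)
  moreover have "degree (p z) \<le> l + 1" for z
    unfolding p_def
    by (intro degree_diff_le degree_add_le degree_monom_le order.trans[OF degree_monom_le]) auto
  moreover have "poly (p (x ^ e)) x = 0" if "x ^ (e - l) = a * x + b" for x
  proof -
    have "x ^ e = x ^ l * x ^ (e - l)"
      using assms(3) by (simp flip: power_add)
    with that show ?thesis
      by (simp add: p_def poly_monom algebra_simps)
  qed
  \<comment> \<open>Now \<open>e - l > 0\<close>, so at 0 the equation would say
    \<open>0 = b\<close>.\<close>
  moreover have "0 \<notin> {x. x ^ (e - l) = a * x + b}"
    using False assms(3,5) by (simp add: power_0_left)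
  ultimately show ?thesis
    by (intro card_le_mult_power_fibres[OF assms(1,2), where p = p]) auto
qed

lemma card_power_add_eq_linear_le:
  fixes a b :: "'a :: {field, finite}"
  assumes "CARD('a) - 1 = d * e" and "d > 0" and "m \<ge> 1" and "b \<noteq> 0"
  shows "card {x. x ^ (e + m) = a * x + b} \<le> d * m"
proof -
  define p where "p z = monom z m - [:b, a:]" for z
  \<comment> \<open>The constant term is the safe witness: for \<open>m = 1\<close> and
    \<open>z = a\<close> the linear terms cancel. As \<open>m \<ge> 1\<close>, the monomial leaves
    the constant term alone.\<close>
  have "coeff (p z) 0 = - b" for z
    using assms(3) by (simp add: p_def)
  then have "p z \<noteq> 0" for z
    using assms(4) by (metis coeff_0 neg_equal_0_iff_equal)
  moreover have "degree (p z) \<le> m" for z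
    unfolding p_def using assms(3)
    by (intro degree_diff_le degree_monom_le) auto
  moreover have "poly (p (x ^ e)) x = 0" if "x ^ (e + m) = a * x + b" for x
    using that by (simp add: p_def poly_monom power_add algebra_simps)
  moreover have "0 \<notin> {x. x ^ (e + m) = a * x + b}"
    using assms(3,4) by (simp add: power_0_left)
  ultimately show ?thesis
    by (intro card_le_mult_power_fibres[OF assms(1,2), where p = p]) auto
qed

theorem theorem3p17:
  fixes q d e :: nat
  assumes "primepow q"
    and "CARD('a :: {field, finite}) = q"
    and "d > 0" and "e > 0"
    and "q - 1 = d * e"
  shows "(\<forall>l\<le>e. \<forall>a b :: 'a. a \<noteq> 0 \<longrightarrow> b \<noteq> 0 \<longrightarrow>
           real (card {x :: 'a. x ^ (e - l) = a * x + b}) \<le> (real l + 1) * (real q - 1) / real e) \<and>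
         (\<forall>m\<ge>1. \<forall>a b :: 'a. a \<noteq> 0 \<longrightarrow> b \<noteq> 0 \<longrightarrow>
           real (card {x :: 'a. x ^ (e + m) = a * x + b}) \<le> real m * (real q - 1) / real e)"
proof -
  have card: "CARD('a) - 1 = d * e"
    using assms(2,5) by simp
  \<comment> \<open>Positivity makes the truncated subtraction \<open>q - 1\<close> on naturals
    agree with the real one.\<close>
  have "q > 0"
    using assms(2) by auto
  then have "real q - 1 = real d * real e"
    using assms(5) by (metis Suc_leI One_nat_def of_nat_1 of_nat_diff of_nat_mult)
  then have d: "r * (real q - 1) / real e = real d * r" for r
    using assms(4) by simp
  have "real (card {x :: 'a. x ^ (e - l) = a * x + b}) \<le> (real l + 1) * (real q - 1) / real e"
    if "l \<le> e" "a \<noteq> 0" "b \<noteq> 0" for l and a b :: 'a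
    using of_nat_mono[OF card_power_diff_eq_linear_le[OF card assms(3) that], where 'a = real]
    unfolding d by (simp add: algebra_simps)
  moreover have "real (card {x :: 'a. x ^ (e + m) = a * x + b}) \<le> real m * (real q - 1) / real e"
    if "m \<ge> 1" "b \<noteq> 0" for m and a b :: 'a
    using of_nat_mono[OF card_power_add_eq_linear_le[OF card assms(3) that], where 'a = real]
    unfolding d by simp
  ultimately show ?thesis
    by blast
qed

end
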